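(* If $(M_n)_{n\in\mathbb{N}}$ is a sequence of maximally invariant statistics $M_n=m_n(X^n)$ for the action of $G$ on $\mathcal{X}^n$, then the process $(T^{M_n})_{n\in\mathbb{N}}$, where $$T^{M_n}=\frac{q^{M_n}(m_n(X^n))}{p^{M_n}(m_n(X^n))},$$ is a nonnegative martingale with respect to the filtration $(\sigma(M_1,\dots,M_n))_{n\in\mathbb{N}}$ under any element $\mathbf{P}_g$, $g\in G$, of the null hypothesis.
   Context: $G$ is a group acting freely on the Polish observation space $\mathcal{X}$ and componentwise on each $\mathcal{X}^n$: $g(x_1,\dots,x_n)=(gx_1,\dots,gx_n)$. Observations $X_1,X_2,\dots$ with values in $\mathcal{X}$ arrive sequentially, and $X^n=(X_1,\dots,X_n)$. The null hypothesis is that the data are distributed according to some $\mathbf{P}_g$, $g\in G$, and the alternative that they are distributed according to some $\mathbf{Q}_g$, $g\in G$. For every $n$ the resulting models for $X^n$ are invariant, i.e. $\mathbf{P}_{hg}\{X^n\in hB\}=\mathbf{P}_g\{X^n\in B\}$ for all $g,h\in G$ and measurable $B\subseteq\mathcal{X}^n$ (similarly for $\mathbf{Q}$), and have densities with respect to a common measure $\mu_n$ on $\mathcal{X}^n$ that is relatively left invariant ($\mu_n\{gB\}=\chi_n(g)\mu_n\{B\}$ for some multiplier $\chi_n$), all densities having a single common support (being positive on one and the same set). Statistics are measurable functions of the data with values in standard Borel spaces. $M_n=m_n(X^n)$ is maximally invariant if $m_n(x)=m_n(x')$ for $x,x'\in\mathcal{X}^n$ if and only if there is $g\in G$ with $x=gx'$.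 By invariance of the models the distribution of $M_n$ under $\mathbf{P}_g$ (resp. $\mathbf{Q}_g$) does not depend on $g$; $p^{M_n}$ and $q^{M_n}$ denote its density under the null and the alternative, respectively, with respect to a common dominating measure. *)

theory Defs
  imports "HOL-Probability.Probability" "HOL-Algebra.Group_Action"
begin

text \<open>Points of the n-fold product space are extensional functions on \<open>{1..n}\<close>. For a Polish
  observation type the product sigma-algebra below is the Borel sigma-algebra of the n-fold product.\<close>

definition obs_space :: "nat \<Rightarrow> (nat \<Rightarrow> 'x::polish_space) measure" where
  "obs_space n = (\<Pi>\<^sub>M i\<in>{1..n}. borel)"

definition sample :: "(nat \<Rightarrow> 'w \<Rightarrow> 'x) \<Rightarrow> nat \<Rightarrow> 'w \<Rightarrow> (nat \<Rightarrow> 'x)" where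
  "sample X n \<omega> = (\<lambda>i\<in>{1..n}. X i \<omega>)"

definition pow_action :: "('g \<Rightarrow> 'x \<Rightarrow> 'x) \<Rightarrow> nat \<Rightarrow> 'g \<Rightarrow> (nat \<Rightarrow> 'x) \<Rightarrow> (nat \<Rightarrow> 'x)" where
  "pow_action \<phi> n g x = (\<lambda>i\<in>{1..n}. \<phi> g (x i))"

definition free_action :: "('g, 'b) monoid_scheme \<Rightarrow> 'x set \<Rightarrow> ('g \<Rightarrow> 'x \<Rightarrow> 'x) \<Rightarrow> bool" where
  "free_action G E \<phi> \<longleftrightarrow> group_action G E \<phi> \<and> (\<forall>x\<in>E. stabilizer G \<phi> x = {\<one>\<^bsub>G\<^esub>})"

definition multiplier :: "('g, 'b) monoid_scheme \<Rightarrow> ('g \<Rightarrow> real) \<Rightarrow> bool" where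
  "multiplier G c \<longleftrightarrow> (\<forall>g\<in>carrier G. 0 < c g) \<and>
     (\<forall>g\<in>carrier G. \<forall>h\<in>carrier G. c (g \<otimes>\<^bsub>G\<^esub> h) = c g * c h)"

definition relatively_left_invariant ::
  "('g, 'b) monoid_scheme \<Rightarrow> ('g \<Rightarrow> 'y \<Rightarrow> 'y) \<Rightarrow> 'y measure \<Rightarrow> bool" where
  "relatively_left_invariant G \<psi> \<mu> \<longleftrightarrow> (\<exists>c. multiplier G c \<and>
     (\<forall>g\<in>carrier G. \<forall>B\<in>sets \<mu>. emeasure \<mu> (\<psi> g ` B) = ennreal (c g) * emeasure \<mu> B))"

definition invariant_model ::
  "('g, 'b) monoid_scheme \<Rightarrow> ('g \<Rightarrow> 'y \<Rightarrow> 'y) \<Rightarrow> 'y measure \<Rightarrow> ('w \<Rightarrow> 'y) \<Rightarrow> ('g \<Rightarrow> 'w measure) \<Rightarrow> bool" where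
  "invariant_model G \<psi> S Y P \<longleftrightarrow> (\<forall>g\<in>carrier G. \<forall>h\<in>carrier G. \<forall>B\<in>sets S.
     \<P>(\<omega> in P (h \<otimes>\<^bsub>G\<^esub> g). Y \<omega> \<in> \<psi> h ` B) = \<P>(\<omega> in P g. Y \<omega> \<in> B))"

definition maximally_invariant ::
  "('g, 'b) monoid_scheme \<Rightarrow> ('g \<Rightarrow> 'y \<Rightarrow> 'y) \<Rightarrow> 'y set \<Rightarrow> ('y \<Rightarrow> 'm) \<Rightarrow> bool" where
  "maximally_invariant G \<psi> E m \<longleftrightarrow>
     (\<forall>x\<in>E. \<forall>x'\<in>E. m x = m x' \<longleftrightarrow> (\<exists>g\<in>carrier G. x = \<psi> g x'))"

definition standard_borel :: "'m measure \<Rightarrow> bool" where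
  "standard_borel N \<longleftrightarrow> (\<exists>T. completely_metrizable_space T \<and> second_countable T \<and>
     space N = topspace T \<and> sets N = sigma_sets (topspace T) {U. openin T U})"

text \<open>The sigma-algebra generated by \<open>M 1, \<dots>, M n\<close>, as a measure space with null measure.\<close>

definition natural_filtration ::
  "'w set \<Rightarrow> (nat \<Rightarrow> 'm measure) \<Rightarrow> (nat \<Rightarrow> 'w \<Rightarrow> 'm) \<Rightarrow> nat \<Rightarrow> 'w measure" where
  "natural_filtration W N M n =
     sigma W (\<Union>k\<in>{1..n}. {M k -` A \<inter> W | A. A \<in> sets (N k)})"

definition martingale_on ::
  "nat set \<Rightarrow> 'w measure \<Rightarrow> (nat \<Rightarrow> 'w measure) \<Rightarrow> (nat \<Rightarrow> 'w \<Rightarrow> real) \<Rightarrow> bool" where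
  "martingale_on I P F Y \<longleftrightarrow>
     (\<forall>i\<in>I. subalgebra P (F i)) \<and>
     (\<forall>i\<in>I. \<forall>j\<in>I. i \<le> j \<longrightarrow> sets (F i) \<subseteq> sets (F j)) \<and>
     (\<forall>i\<in>I. Y i \<in> borel_measurable (F i)) \<and>
     (\<forall>i\<in>I. integrable P (Y i)) \<and>
     (\<forall>i\<in>I. \<forall>j\<in>I. i \<le> j \<longrightarrow> (AE \<omega> in P. real_cond_exp P (F i) (Y j) \<omega> = Y i \<omega>))"

end

theory Submission
  imports Defs
begin

text \<open>
  Fix \<open>g\<close>. The statistic \<open>T n\<close> is the likelihood ratio of \<open>Q g\<close> against \<open>P g\<close> for the single
  statistic \<open>M n\<close>, so \<open>E[T n; M n \<in> C] = Q g (M n \<in> C)\<close> under \<open>P g\<close>. The martingale property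
  is immediate once this extends to every event \<open>A\<close> of \<open>\<sigma>(M 1, \<dots>, M n)\<close>, i.e. once
  \<open>E[T n; A] = Q g (A)\<close>: the right-hand side does not mention \<open>n\<close>, so for \<open>A\<close> in
  \<open>\<sigma>(M 1, \<dots>, M i)\<close> and \<open>i \<le> j\<close> the integrals of \<open>T i\<close> and \<open>T j\<close> over \<open>A\<close> agree
  (\<open>likelihood_ratio_martingale_on\<close>, \<open>nn_integral_density_ratio\<close>).

  The crux is therefore that \<open>M n\<close> alone carries all the information in \<open>M 1, \<dots>, M n\<close>. As points
  in one orbit of \<open>G\<close> on the n-fold product have initial segments in one orbit on the k-fold
  product, \<open>M k\<close> is a function of \<open>M n\<close> for \<open>k \<le> n\<close>; but this function need not come with any
  measurability. The classical remedy is Blackwell's theorem: a Borel set which is a union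
  of fibres of a measurable map on a Polish space belongs to the sigma-algebra generated by the
  map. Its usual proof separates analytic sets. Here it is enough to know it up to null sets, and
  that version (\<open>saturated_eq_vimage_AE\<close>) follows from Lusin's theorem: fill the saturated set up
  to measure zero by compact sets on which the map is continuous; their images are compact, and by
  saturation the preimage of the images stays inside the set.

  The null sets must be null under both \<open>P g\<close> and \<open>Q g\<close>. This is where the common support of
  the densities enters: it makes the laws of \<open>X\<^sup>n\<close> mutually absolutely continuous. The same fact
  excludes that \<open>M n\<close> has positive \<open>Q g\<close>-probability on the set where its null density vanishes, which
  would make the expectation of the ratio less than one. Invariance of the models shows that the
  law of \<open>M n\<close> is the same for all group elements, so that the densities \<open>pM\<close> and \<open>qM\<close>, given for
  some group element, are densities for the fixed \<open>g\<close> as well.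
\<close>

section \<open>Saturated Borel sets in Polish spaces\<close>

lemma inner_compact_approx:
  fixes R :: "'a::polish_space measure"
  assumes "sets R = sets borel" "finite_measure R" "A \<in> sets R" "0 < \<epsilon>"
  obtains K where "compact K" "K \<subseteq> A" "emeasure R (A - K) \<le> ennreal \<epsilon>"
proof -
  interpret finite_measure R by fact
  have "emeasure R A = (SUP K\<in>{K. K \<subseteq> A \<and> compact K}. emeasure R K)"
    using assms by (intro inner_regular) (auto simp: emeasure_finite)
  moreover have "{K. K \<subseteq> A \<and> compact K} \<noteq> {}" by auto
  ultimately obtain K where K: "K \<subseteq> A" "compact K" "emeasure R A < emeasure R K + ennreal \<epsilon>"
    using SUP_approx_ennreal[of \<epsilon> "{K. K \<subseteq> A \<and> compact K}" "emeasure R A" "emeasure R"] assms(4)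
    by (metis (mono_tags, lifting) emeasure_finite infinity_ennreal_def mem_Collect_eq)
  have "K \<in> sets R" using K assms(1) by (simp add: borel_compact)
  then have "emeasure R (A - K) = emeasure R A - emeasure R K"
    using K assms(3) by (intro emeasure_Diff) auto
  also have "\<dots> \<le> ennreal \<epsilon>"
    using K(3) by (simp add: ennreal_minus_le_iff emeasure_finite less_imp_le add.commute)
  finally show thesis using that K by blast
qed

text \<open>Lusin's theorem. Continuity on \<open>K\<close> holds as soon as, for each member \<open>B k\<close> of a countable base,
  the preimage of \<open>B k\<close> is relatively open in \<open>K\<close>. Approximating both this preimage and its
  complement in \<open>A\<close> from inside by disjoint compact sets, and intersecting over \<open>k\<close>, achieves this.\<close>

lemma lusin:
  fixes R :: "'a::polish_space measure" and f :: "'a \<Rightarrow> 'b::second_countable_topology"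
  assumes "sets R = sets borel" "finite_measure R" "f \<in> borel_measurable R" "A \<in> sets R" "0 < \<epsilon>"
  obtains K where "compact K" "K \<subseteq> A" "emeasure R (A - K) \<le> ennreal \<epsilon>" "continuous_on K f"
proof -
  interpret finite_measure R by fact
  note [measurable] = assms(3,4)
  have spR: "space R = UNIV"
    using sets_eq_imp_space_eq[OF assms(1)] by simp
  obtain \<B> :: "'b set set" where \<B>: "countable \<B>" "topological_basis \<B>"
    using ex_countable_basis by blast
  then have ne: "\<B> \<noteq> {}"
    by (metis UNIV_I empty_iff open_UNIV topological_basisE)
  define B where "B = from_nat_into \<B>"
  have range_B: "range B = \<B>"
    unfolding B_def using ne \<B>(1) by (rule range_from_nat_into)
  have B_open: "open (B k)" for k
    using topological_basis_open[OF \<B>(2)] range_B by blast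
  have f_B [measurable]: "f -` B k \<in> sets R" for k
    using measurable_sets[OF assms(3), of "B k"] B_open spR by simp
  \<comment> \<open>The two errors at stage \<open>k\<close> add up to \<open>\<epsilon> / 2 ^ Suc k\<close>, so that all stages together cost \<open>\<epsilon>\<close>.\<close>
  define \<delta> where "\<delta> k = \<epsilon> / 2 * (1/2) ^ Suc k" for k :: nat
  have \<delta>: "\<delta> k > 0" for k using assms(5) by (simp add: \<delta>_def)
  have "\<exists>K L. compact K \<and> compact L \<and> K \<subseteq> A \<inter> f -` B k \<and> L \<subseteq> A - f -` B k \<and>
      emeasure R (A \<inter> f -` B k - K) \<le> ennreal (\<delta> k) \<and> emeasure R (A - f -` B k - L) \<le> ennreal (\<delta> k)"
    for k
    using inner_compact_approx[OF assms(1,2) _ \<delta>[of k], of "A \<inter> f -` B k"]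
      inner_compact_approx[OF assms(1,2) _ \<delta>[of k], of "A - f -` B k"]
    by (metis sets.Int sets.Diff assms(4) f_B)
  then obtain K L where KL: "\<And>k. compact (K k)" "\<And>k. compact (L k)"
      "\<And>k. K k \<subseteq> A \<inter> f -` B k" "\<And>k. L k \<subseteq> A - f -` B k"
      "\<And>k. emeasure R (A \<inter> f -` B k - K k) \<le> ennreal (\<delta> k)"
      "\<And>k. emeasure R (A - f -` B k - L k) \<le> ennreal (\<delta> k)"
    by metis
  have [measurable]: "K k \<in> sets R" "L k \<in> sets R" for k
    using KL(1,2) assms(1) by (auto simp: borel_compact)
  define C where "C = (\<Inter>k. K k \<union> L k)"
  have "compact C"
  proof -
    have "closed C"
      unfolding C_def by (intro closed_INT ballI closed_Un compact_imp_closed KL(1,2))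
    then have "compact ((K 0 \<union> L 0) \<inter> C)"
      by (intro compact_Int_closed compact_Un KL(1,2))
    moreover have "(K 0 \<union> L 0) \<inter> C = C" unfolding C_def by blast
    ultimately show ?thesis by simp
  qed
  moreover have "C \<subseteq> A"
    using KL(3,4) unfolding C_def by blast
  moreover have "emeasure R (A - C) \<le> ennreal \<epsilon>"
  proof -
    have sums: "(\<lambda>k. \<delta> k + \<delta> k) sums \<epsilon>"
      using sums_mult[OF power_half_series, of \<epsilon>] by (simp add: \<delta>_def field_simps)
    have "A - C = (\<Union>k. (A \<inter> f -` B k - K k) \<union> (A - f -` B k - L k))"
      using KL(3,4) unfolding C_def by blast
    then have "emeasure R (A - C) \<le> (\<Sum>k. emeasure R ((A \<inter> f -` B k - K k) \<union> (A - f -` B k - L k)))"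
      by (auto intro!: emeasure_subadditive_countably)
    also have "\<dots> \<le> (\<Sum>k. ennreal (\<delta> k + \<delta> k))"
    proof (intro suminf_le)
      fix k
      have "emeasure R ((A \<inter> f -` B k - K k) \<union> (A - f -` B k - L k)) \<le>
        emeasure R (A \<inter> f -` B k - K k) + emeasure R (A - f -` B k - L k)"
        by (intro emeasure_subadditive) auto
      also have "\<dots> \<le> ennreal (\<delta> k + \<delta> k)"
        using add_mono[OF KL(5)[of k] KL(6)[of k]] \<delta>[of k] by (simp add: ennreal_plus[symmetric] del: ennreal_plus)
      finally show "emeasure R ((A \<inter> f -` B k - K k) \<union> (A - f -` B k - L k)) \<le> ennreal (\<delta> k + \<delta> k)" .
    qed auto
    also have "\<dots> = ennreal \<epsilon>"
      using sums \<delta> by (intro suminf_ennreal_eq) (auto intro: less_imp_le add_nonneg_nonneg)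
    finally show ?thesis .
  qed
  moreover have "continuous_on C f"
    unfolding continuous_on_open_invariant
  proof (intro allI impI)
    fix V :: "'b set" assume "open V"
    then obtain I where I: "I \<subseteq> \<B>" "V = \<Union>I"
      using \<B>(2) unfolding topological_basis_def by metis
    have I': "V = (\<Union>k\<in>{k. B k \<in> I}. B k)"
      using I range_B by blast
    \<comment> \<open>A point of \<open>C\<close> outside \<open>L k\<close> lies in \<open>K k\<close>, so the closed set \<open>L k\<close> decides membership in
      the preimage of \<open>B k\<close>.\<close>
    have "f -` B k \<inter> C = - L k \<inter> C" for k
      using KL(3,4)[of k] unfolding C_def by blast
    then have "(\<Union>k\<in>{k. B k \<in> I}. - L k) \<inter> C = f -` V \<inter> C"
      unfolding I' by blast
    moreover have "open (\<Union>k\<in>{k. B k \<in> I}. - L k)"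
      using KL(2) by (auto intro!: open_UN open_Compl compact_imp_closed)
    ultimately show "\<exists>U. open U \<and> U \<inter> C = f -` V \<inter> C"
      by blast
  qed
  ultimately show thesis using that by blast
qed

text \<open>Blackwell's theorem modulo null sets. By Lusin's theorem \<open>A\<close> is, up to a null set, a
  countable union of compact sets on which \<open>f\<close> is continuous. The union \<open>C\<close> of their images is
  sigma-compact, hence Borel, and saturation prevents its preimage from leaving \<open>A\<close>.\<close>

lemma saturated_eq_vimage_AE:
  fixes R :: "'a::polish_space measure" and f :: "'a \<Rightarrow> 'b::{second_countable_topology, t2_space}"
  assumes "sets R = sets borel" "finite_measure R" "f \<in> borel_measurable R" "A \<in> sets R"
    and sat: "\<And>x x'. f x = f x' \<Longrightarrow> x \<in> A \<Longrightarrow> x' \<in> A"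
  obtains C where "C \<in> sets borel" "AE x in R. x \<in> A \<longleftrightarrow> f x \<in> C"
proof -
  note [measurable] = assms(3,4)
  have spR: "space R = UNIV"
    using sets_eq_imp_space_eq[OF assms(1)] by simp
  have "\<exists>K. compact K \<and> K \<subseteq> A \<and> emeasure R (A - K) \<le> ennreal (1 / Suc j) \<and> continuous_on K f" for j
    using lusin[OF assms(1-4), of "1 / Suc j"] by (metis of_nat_0_less_iff zero_less_Suc zero_less_divide_1_iff)
  then obtain K where K: "\<And>j. compact (K j)" "\<And>j. K j \<subseteq> A"
      "\<And>j. emeasure R (A - K j) \<le> ennreal (1 / Suc j)" "\<And>j. continuous_on (K j) f"
    by metis
  define C where "C = (\<Union>j. f ` K j)"
  have C: "C \<in> sets borel"
    unfolding C_def using K by (intro sets.countable_UN) (auto intro!: borel_compact compact_continuous_image)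
  have CA: "f -` C \<subseteq> A"
    using K(2) sat unfolding C_def by (auto simp: subset_iff)
  have fC: "f -` C \<in> sets R"
    using measurable_sets[OF assms(3) C] spR by simp
  have "emeasure R (A - f -` C) \<le> ennreal (1 / Suc j)" for j
  proof -
    have "A - f -` C \<subseteq> A - K j" unfolding C_def by blast
    then have "emeasure R (A - f -` C) \<le> emeasure R (A - K j)"
      using K(1) assms(1,4) by (intro emeasure_mono) (auto simp: borel_compact)
    then show ?thesis using K(3) order_trans by blast
  qed
  moreover have "(\<lambda>j. ennreal (1 / Suc j)) \<longlonglongrightarrow> 0"
    using tendsto_ennrealI[OF LIMSEQ_Suc[OF lim_1_over_n]] by simp
  ultimately have "emeasure R (A - f -` C) = 0"
    using LIMSEQ_le_const by (metis le_zero_eq)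
  then have "A - f -` C \<in> null_sets R"
    using fC by auto
  then have "AE x in R. x \<in> A \<longleftrightarrow> f x \<in> C"
    by (rule AE_mp[OF AE_not_in]) (use CA in auto)
  then show thesis using that C by blast
qed

text \<open>Indicators of a countable base separate the points of a Hausdorff space. The embedding moves
  statistics with values in an abstract standard Borel space to the second countable Hausdorff
  type \<open>nat \<Rightarrow> real\<close>, where images of compact sets under continuous maps are Borel.\<close>

lemma standard_borel_imp_injective_measurable:
  assumes "standard_borel N"
  obtains e :: "'m \<Rightarrow> nat \<Rightarrow> real" where "e \<in> borel_measurable N" "inj_on e (space N)"
proof -
  obtain T where T: "completely_metrizable_space T" "second_countable T" "space N = topspace T"
     "sets N = sigma_sets (topspace T) {U. openin T U}"
    using assms unfolding standard_borel_def by blast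
  have t2: "Hausdorff_space T"
    using T(1) by (simp add: completely_metrizable_imp_metrizable_space metrizable_imp_Hausdorff_space)
  obtain \<B> where \<B>: "countable \<B>" "\<And>V. V \<in> \<B> \<Longrightarrow> openin T V"
     "\<And>U x. openin T U \<Longrightarrow> x \<in> U \<Longrightarrow> \<exists>V\<in>\<B>. x \<in> V \<and> V \<subseteq> U"
    using T(2) unfolding second_countable_def by metis
  \<comment> \<open>The empty set is added because \<open>\<B>\<close> may be empty when \<open>T\<close> is.\<close>
  define B where "B = from_nat_into (insert {} \<B>)"
  have B: "range B = insert {} \<B>"
    unfolding B_def using \<B>(1) by (intro range_from_nat_into) auto
  define e :: "'m \<Rightarrow> nat \<Rightarrow> real" where "e y k = indicator (B k) y" for y k
  have BN: "B k \<in> sets N" for k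
  proof -
    have "B k \<in> insert {} \<B>" using B by blast
    then show ?thesis using \<B>(2) T(4) by (auto intro: sigma_sets.intros)
  qed
  have "e \<in> borel_measurable N"
    by (rule measurable_coordinatewise_then_product)
      (use BN in \<open>auto simp: e_def[abs_def] intro!: borel_measurable_indicator\<close>)
  moreover have "inj_on e (space N)"
  proof (rule inj_onI, rule ccontr)
    fix y z assume *: "y \<in> space N" "z \<in> space N" "e y = e z" "y \<noteq> z"
    then obtain U where U: "openin T U" "y \<in> U" "z \<notin> U"
      using t2 T(3) unfolding Hausdorff_space_def by (metis disjnt_iff)
    then obtain V where "V \<in> \<B>" "y \<in> V" "z \<notin> V" using \<B>(3) by blast
    moreover obtain k where "V = B k" using \<open>V \<in> \<B>\<close> B by (metis insertI2 rangeE)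
    ultimately have "e y k \<noteq> e z k" by (simp add: e_def)
    with *(3) show False by simp
  qed
  ultimately show thesis using that by blast
qed


section \<open>Events of the filtration are events of the last maximal invariant\<close>

text \<open>Blackwell's theorem modulo null sets on the n-fold product. The points of \<open>obs_space n\<close> do not
  form a Polish type of their own, so the law is pushed to the full sequence type \<open>nat \<Rightarrow> 'x\<close>, which
  does, and events and statistics are pulled back along the restriction to \<open>{1..n}\<close>.\<close>

lemma saturated_obs_event_eq_vimage_AE:
  fixes W :: "(nat \<Rightarrow> 'x::polish_space) measure"
  assumes W: "sets W = sets (obs_space n)" "finite_measure W"
    and N: "standard_borel (N :: 'm measure)" and m: "m \<in> obs_space n \<rightarrow>\<^sub>M N" and A: "A \<in> sets (obs_space n)"
    and sat: "\<And>x x'. x \<in> space (obs_space n) \<Longrightarrow> x' \<in> space (obs_space n) \<Longrightarrow> m x = m x' \<Longrightarrow>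
      x \<in> A \<Longrightarrow> x' \<in> A"
  obtains C where "C \<in> sets N" "AE x in W. x \<in> A \<longleftrightarrow> m x \<in> C"
proof -
  obtain e :: "'m \<Rightarrow> nat \<Rightarrow> real" where e: "e \<in> borel_measurable N" "inj_on e (space N)"
    using standard_borel_imp_injective_measurable[OF N] .
  define r :: "(nat \<Rightarrow> 'x) \<Rightarrow> nat \<Rightarrow> 'x" where "r x = restrict x {1..n}" for x
  have spW: "space W = space (obs_space n)"
    using W(1) by (rule sets_eq_imp_space_eq)
  have r: "r \<in> borel \<rightarrow>\<^sub>M obs_space n"
    unfolding r_def obs_space_def by (rule measurable_restrict) (rule measurable_product_coordinates)
  have r_id: "r x = x" if "x \<in> space (obs_space n)" for x
    using that by (auto simp: r_def obs_space_def space_PiM)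
  have incl: "(\<lambda>x. x) \<in> (obs_space n :: (nat \<Rightarrow> 'x) measure) \<rightarrow>\<^sub>M borel"
  proof (rule measurable_coordinatewise_then_product)
    fix i
    show "(\<lambda>x. x i) \<in> obs_space n \<rightarrow>\<^sub>M (borel :: 'x measure)"
    proof (cases "i \<in> {1..n}")
      case True
      then show ?thesis unfolding obs_space_def by (rule measurable_component_singleton)
    next
      case False
      have "x i = undefined" if "x \<in> space (obs_space n)" for x :: "nat \<Rightarrow> 'x"
        using that False by (auto simp: obs_space_def space_PiM PiE_def extensional_def)
      then show ?thesis
        by (subst measurable_cong[where g = "\<lambda>_. undefined"]) auto
    qed
  qed
  have incl_W: "(\<lambda>x. x) \<in> W \<rightarrow>\<^sub>M borel"
    using incl by (simp add: measurable_cong_sets[OF W(1)])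
  define R where "R = distr W borel (\<lambda>x. x)"
  have R: "sets R = sets borel" "finite_measure R"
    using finite_measure.finite_measure_distr[OF W(2) incl_W] by (simp_all add: R_def)
  have f: "(\<lambda>x. e (m (r x))) \<in> borel_measurable R"
    using measurable_compose[OF measurable_compose[OF r m] e(1)] by (simp add: R_def)
  have rA: "r -` A \<in> sets R"
    using measurable_sets[OF r A] by (simp add: R_def)
  have sat': "x' \<in> r -` A" if "e (m (r x)) = e (m (r x'))" "x \<in> r -` A" for x x'
  proof -
    have "r x \<in> space (obs_space n)" "r x' \<in> space (obs_space n)"
      using measurable_space[OF r] by auto
    moreover from this have "m (r x) = m (r x')"
      using that(1) e(2) measurable_space[OF m] by (auto dest: inj_onD)
    ultimately show ?thesis using sat that(2) by blast
  qed
  obtain C where C: "C \<in> sets borel" "AE x in R. x \<in> r -` A \<longleftrightarrow> e (m (r x)) \<in> C"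
    by (rule saturated_eq_vimage_AE[OF R f rA sat'])
  have "AE x in W. x \<in> r -` A \<longleftrightarrow> e (m (r x)) \<in> C"
    using C(2) unfolding R_def by (rule AE_distrD[OF incl_W])
  then have "AE x in W. x \<in> A \<longleftrightarrow> m x \<in> e -` C \<inter> space N"
    using AE_space by eventually_elim (use r_id measurable_space[OF m] spW in auto)
  moreover have "e -` C \<inter> space N \<in> sets N"
    using e(1) C(1) by (rule measurable_sets)
  ultimately show thesis by (rule that[rotated])
qed

lemma pow_action_in_space: "pow_action \<phi> n g x \<in> space (obs_space n)"
  by (auto simp: pow_action_def obs_space_def space_PiM)

lemma sample_in_space: "sample X n \<omega> \<in> space (obs_space n)"
  by (auto simp: sample_def obs_space_def space_PiM)

lemma restrict_in_space: "restrict x {1..n} \<in> space (obs_space n)"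
  by (auto simp: obs_space_def space_PiM)

text \<open>A group element taking \<open>x'\<close> to \<open>x\<close> also takes the initial segment of \<open>x'\<close> to that of \<open>x\<close>.
  Hence a maximal invariant of \<open>n\<close> observations determines the one of the first \<open>k\<close>.\<close>

lemma maximally_invariant_restrict:
  assumes "maximally_invariant G (pow_action \<phi> n) (space (obs_space n)) m"
    and "maximally_invariant G (pow_action \<phi> k) (space (obs_space k)) m'"
    and "k \<le> n" "x \<in> space (obs_space n)" "x' \<in> space (obs_space n)" "m x = m x'"
  shows "m' (restrict x {1..k}) = m' (restrict x' {1..k})"
proof -
  obtain g where g: "g \<in> carrier G" "x = pow_action \<phi> n g x'"
    using assms unfolding maximally_invariant_def by blast
  then have "restrict x {1..k} = pow_action \<phi> k g (restrict x' {1..k})"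
    using assms(3) by (auto simp: pow_action_def restrict_def)
  then show ?thesis
    using assms(2) g(1) restrict_in_space unfolding maximally_invariant_def by blast
qed

text \<open>Events that agree with some event of \<open>M n\<close> up to a common null set of \<open>P\<close> and \<open>Q\<close> form a
  sigma-algebra, so only the generating events \<open>M k \<in> B\<close> need an argument. Those depend on the
  orbit of \<open>X\<^sup>n\<close> only and are therefore saturated. Absolute continuity transports the exceptional set
  from \<open>P\<close> to \<open>Q\<close>; it is required only for laws of the sample, since \<open>P\<close> and \<open>Q\<close> themselves
  may well be mutually singular on the whole sequence of observations.\<close>

lemma natural_filtration_eq_vimage_AE:
  fixes X :: "nat \<Rightarrow> 'w \<Rightarrow> 'x::polish_space" and P Q :: "'w measure"
  assumes P: "prob_space P" and sp: "space P = W" "space Q = W" and n: "1 \<le> n"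
    and X: "sample X n \<in> P \<rightarrow>\<^sub>M obs_space n" "sample X n \<in> Q \<rightarrow>\<^sub>M obs_space n"
    and ac: "absolutely_continuous (distr P (obs_space n) (sample X n)) (distr Q (obs_space n) (sample X n))"
    and N: "standard_borel (N n)" and m: "\<And>k. 1 \<le> k \<Longrightarrow> k \<le> n \<Longrightarrow> m k \<in> obs_space k \<rightarrow>\<^sub>M N k"
    and max: "\<And>k. 1 \<le> k \<Longrightarrow> k \<le> n \<Longrightarrow> maximally_invariant G (pow_action \<phi> k) (space (obs_space k)) (m k)"
    and M: "\<And>k \<omega>. M k \<omega> = m k (sample X k \<omega>)"
    and A: "A \<in> sets (natural_filtration W N M n)"
  obtains C where "C \<in> sets (N n)" "AE \<omega> in P. \<omega> \<in> A \<longleftrightarrow> M n \<omega> \<in> C" "AE \<omega> in Q. \<omega> \<in> A \<longleftrightarrow> M n \<omega> \<in> C"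
proof -
  have M_space: "M n \<omega> \<in> space (N n)" for \<omega>
    using measurable_space[OF m[of n] sample_in_space] n by (simp add: M)
  have "A \<in> sigma_sets W (\<Union>k\<in>{1..n}. {M k -` B \<inter> W | B. B \<in> sets (N k)})"
    using A unfolding natural_filtration_def by (subst (asm) sets_measure_of) auto
  then have "\<exists>C\<in>sets (N n). (AE \<omega> in P. \<omega> \<in> A \<longleftrightarrow> M n \<omega> \<in> C) \<and> (AE \<omega> in Q. \<omega> \<in> A \<longleftrightarrow> M n \<omega> \<in> C)"
  proof induction
    case (Basic A)
    then obtain k B where k: "1 \<le> k" "k \<le> n" "A = M k -` B \<inter> W" "B \<in> sets (N k)" by auto
    define A' where "A' = (\<lambda>x. m k (restrict x {1..k})) -` B \<inter> space (obs_space n)"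
    have "(\<lambda>x. restrict x {1..k}) \<in> obs_space n \<rightarrow>\<^sub>M (obs_space k :: (nat \<Rightarrow> 'x) measure)"
      unfolding obs_space_def using k(2) by (intro measurable_restrict measurable_component_singleton) auto
    then have A': "A' \<in> sets (obs_space n)"
      unfolding A'_def using k(4) by (rule measurable_sets[OF measurable_compose[OF _ m[OF k(1,2)]]])
    have fin: "finite_measure (distr P (obs_space n) (sample X n))"
      using P X(1) by (simp add: prob_space.finite_measure prob_space.prob_space_distr)
    have sat: "x' \<in> A'" if "x \<in> space (obs_space n)" "x' \<in> space (obs_space n)" "m n x = m n x'" "x \<in> A'" for x x'
      using maximally_invariant_restrict[OF max[OF n order_refl] max[OF k(1,2)] k(2) that(1-3)] that(2,4)
      by (simp add: A'_def)
    obtain C where C: "C \<in> sets (N n)"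
        "AE x in distr P (obs_space n) (sample X n). x \<in> A' \<longleftrightarrow> m n x \<in> C"
      by (rule saturated_obs_event_eq_vimage_AE[OF sets_distr fin N m[OF n order_refl] A' sat])
    have CQ: "AE x in distr Q (obs_space n) (sample X n). x \<in> A' \<longleftrightarrow> m n x \<in> C"
      using absolutely_continuous_AE[OF _ ac C(2)] by simp
    have "restrict (sample X n \<omega>) {1..k} = sample X k \<omega>" for \<omega>
      using k(2) by (auto simp: sample_def restrict_def)
    then have iff: "\<omega> \<in> A \<longleftrightarrow> sample X n \<omega> \<in> A'" if "\<omega> \<in> W" for \<omega>
      using that by (simp add: k(3) A'_def M sample_in_space)
    have "AE \<omega> in P. \<omega> \<in> A \<longleftrightarrow> M n \<omega> \<in> C"
      using AE_distrD[OF X(1) C(2)] AE_space by eventually_elim (simp add: iff M sp)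
    moreover have "AE \<omega> in Q. \<omega> \<in> A \<longleftrightarrow> M n \<omega> \<in> C"
      using AE_distrD[OF X(2) CQ] AE_space by eventually_elim (simp add: iff M sp)
    ultimately show ?case
      using C(1) by (intro bexI[of _ C] conjI)
  next
    case Empty
    then show ?case by (intro bexI[of _ "{}"]) auto
  next
    case (Compl A)
    then obtain C where C: "C \<in> sets (N n)" "AE \<omega> in P. \<omega> \<in> A \<longleftrightarrow> M n \<omega> \<in> C" "AE \<omega> in Q. \<omega> \<in> A \<longleftrightarrow> M n \<omega> \<in> C"
      by blast
    have "AE \<omega> in P. \<omega> \<in> W - A \<longleftrightarrow> M n \<omega> \<in> space (N n) - C"
      using C(2) AE_space by eventually_elim (simp add: sp M_space)
    moreover have "AE \<omega> in Q. \<omega> \<in> W - A \<longleftrightarrow> M n \<omega> \<in> space (N n) - C"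
      using C(3) AE_space by eventually_elim (simp add: sp M_space)
    ultimately show ?case
      using C(1) by (intro bexI[of _ "space (N n) - C"] conjI) auto
  next
    case (Union A)
    have "\<exists>C. \<forall>i. C i \<in> sets (N n) \<and> (AE \<omega> in P. \<omega> \<in> A i \<longleftrightarrow> M n \<omega> \<in> C i) \<and>
        (AE \<omega> in Q. \<omega> \<in> A i \<longleftrightarrow> M n \<omega> \<in> C i)"
      using Union.IH by (intro choice allI) (simp add: Bex_def)
    then obtain C where C: "\<forall>i. C i \<in> sets (N n) \<and> (AE \<omega> in P. \<omega> \<in> A i \<longleftrightarrow> M n \<omega> \<in> C i) \<and>
        (AE \<omega> in Q. \<omega> \<in> A i \<longleftrightarrow> M n \<omega> \<in> C i)"
      by (rule exE)
    then have "AE \<omega> in P. \<forall>i. \<omega> \<in> A i \<longleftrightarrow> M n \<omega> \<in> C i" "AE \<omega> in Q. \<forall>i. \<omega> \<in> A i \<longleftrightarrow> M n \<omega> \<in> C i"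
      by (simp_all add: AE_all_countable)
    then have "AE \<omega> in P. \<omega> \<in> (\<Union>i. A i) \<longleftrightarrow> M n \<omega> \<in> (\<Union>i. C i)"
        "AE \<omega> in Q. \<omega> \<in> (\<Union>i. A i) \<longleftrightarrow> M n \<omega> \<in> (\<Union>i. C i)"
      by (auto elim!: eventually_mono)
    then show ?case
      using C by (intro bexI[of _ "\<Union>i. C i"] conjI) auto
  qed
  then show thesis
    by (elim bexE conjE) (rule that)
qed

section \<open>Likelihood ratios and the laws of maximal invariants\<close>

text \<open>Since division by zero yields zero, the ratio loses the mass that \<open>Q\<close> puts on
  \<open>{p = 0}\<close>. Absolute continuity makes this mass zero.\<close>

lemma nn_integral_density_ratio:
  fixes p q :: "'b \<Rightarrow> real"
  assumes P: "distributed P \<nu> Y (\<lambda>y. ennreal (p y))" and Q: "distributed Q \<nu> Y (\<lambda>y. ennreal (q y))"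
    and nonneg: "\<And>y. y \<in> space \<nu> \<Longrightarrow> 0 \<le> p y \<and> 0 \<le> q y"
    and ac: "absolutely_continuous (distr P \<nu> Y) (distr Q \<nu> Y)" and C: "C \<in> sets \<nu>"
  shows "(\<integral>\<^sup>+\<omega>. ennreal (q (Y \<omega>) / p (Y \<omega>)) * indicator C (Y \<omega>) \<partial>P) = emeasure Q (Y -` C \<inter> space Q)"
proof -
  note [measurable] = C
  have pq [measurable]: "(\<lambda>y. ennreal (p y)) \<in> borel_measurable \<nu>" "(\<lambda>y. ennreal (q y)) \<in> borel_measurable \<nu>"
    using P Q by (auto simp: distributed_def)
  have pq_real [measurable]: "p \<in> borel_measurable \<nu>" "q \<in> borel_measurable \<nu>"
    using distributed_real_measurable[OF _ P] distributed_real_measurable[OF _ Q] nonneg by auto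
  have "{y\<in>space \<nu>. ennreal (p y) = 0} \<in> null_sets (density \<nu> (\<lambda>y. ennreal (p y)))"
    by (subst null_sets_density_iff) auto
  then have "{y\<in>space \<nu>. ennreal (p y) = 0} \<in> null_sets (density \<nu> (\<lambda>y. ennreal (q y)))"
    using ac P Q by (auto simp: absolutely_continuous_def distributed_def)
  then have "AE y in \<nu>. y \<in> {y\<in>space \<nu>. ennreal (p y) = 0} \<longrightarrow> ennreal (q y) = 0"
    by (subst (asm) null_sets_density_iff) auto
  then have "AE y in \<nu>. ennreal (p y) * (ennreal (q y / p y) * indicator C y) = ennreal (q y) * indicator C y"
    using AE_space
  proof eventually_elim
    case (elim y)
    then show ?case
      using nonneg[of y] by (cases "p y = 0") (auto simp: ennreal_mult[symmetric] mult.assoc[symmetric])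
  qed
  then have "(\<integral>\<^sup>+y. ennreal (p y) * (ennreal (q y / p y) * indicator C y) \<partial>\<nu>) = (\<integral>\<^sup>+y. ennreal (q y) * indicator C y \<partial>\<nu>)"
    by (rule nn_integral_cong_AE)
  also have "\<dots> = emeasure Q (Y -` C \<inter> space Q)"
    using Q C by (simp add: distributed_emeasure)
  finally show ?thesis
    using distributed_nn_integral[OF P, of "\<lambda>y. ennreal (q y / p y) * indicator C y"] by simp
qed

text \<open>Invariant events are mapped onto themselves, not only into themselves, because every group
  element is undone by its inverse. This turns the hypothesis of an invariant model, which speaks
  about images of events, into a statement about one and the same event.\<close>

lemma pow_action_image_saturated:
  assumes act: "group_action G UNIV \<phi>" and h: "h \<in> carrier G"
    and max: "maximally_invariant G (pow_action \<phi> n) (space (obs_space n)) m"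
  shows "pow_action \<phi> n h ` (m -` C \<inter> space (obs_space n)) = m -` C \<inter> space (obs_space n)"
    (is "_ ` ?B = ?B")
proof -
  interpret group_action G UNIV \<phi> by fact
  have inv: "m (pow_action \<phi> n g x) = m x" if "g \<in> carrier G" "x \<in> space (obs_space n)" for g x
    using max that pow_action_in_space[of \<phi> n g x] unfolding maximally_invariant_def by blast
  have "pow_action \<phi> n h ` ?B \<subseteq> ?B"
    using h by (auto simp: inv pow_action_in_space)
  moreover have "y \<in> pow_action \<phi> n h ` ?B" if y: "y \<in> ?B" for y
  proof
    have hi: "inv\<^bsub>G\<^esub> h \<in> carrier G"
      using h group_hom by (simp add: group_hom_def)
    have "\<phi> h (\<phi> (inv\<^bsub>G\<^esub> h) z) = z" for z
      using orbit_sym_aux[OF hi, of z] h group_hom by (simp add: group_hom_def)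
    then show "y = pow_action \<phi> n h (pow_action \<phi> n (inv\<^bsub>G\<^esub> h) y)"
      using y by (auto simp: pow_action_def obs_space_def space_PiM PiE_def extensional_def restrict_def)
    show "pow_action \<phi> n (inv\<^bsub>G\<^esub> h) y \<in> ?B"
      using y hi by (auto simp: inv pow_action_in_space)
  qed
  ultimately show ?thesis by blast
qed

text \<open>The group element \<open>h (inv g)\<close> carries the model at \<open>g\<close> to the model at \<open>h\<close> and leaves every
  event of the maximal invariant in place.\<close>

lemma distr_maximal_invariant_eq:
  assumes act: "group_action G UNIV \<phi>"
    and prob: "\<And>g. g \<in> carrier G \<Longrightarrow> prob_space (P g)"
    and X: "\<And>g. g \<in> carrier G \<Longrightarrow> sample X n \<in> P g \<rightarrow>\<^sub>M obs_space n"
    and inv: "invariant_model G (pow_action \<phi> n) (obs_space n) (sample X n) P"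
    and m: "m \<in> obs_space n \<rightarrow>\<^sub>M N"
    and max: "maximally_invariant G (pow_action \<phi> n) (space (obs_space n)) m"
    and g: "g \<in> carrier G" and h: "h \<in> carrier G"
  shows "distr (P g) N (\<lambda>\<omega>. m (sample X n \<omega>)) = distr (P h) N (\<lambda>\<omega>. m (sample X n \<omega>))"
proof (rule measure_eqI)
  fix C assume "C \<in> sets (distr (P g) N (\<lambda>\<omega>. m (sample X n \<omega>)))"
  then have C: "C \<in> sets N" by simp
  interpret group G using act by (simp add: group_action_def group_hom_def)
  let ?B = "m -` C \<inter> space (obs_space n)"
  have B: "?B \<in> sets (obs_space n)" using m C by (rule measurable_sets)
  have em: "emeasure (distr (P k) N (\<lambda>\<omega>. m (sample X n \<omega>))) C = ennreal \<P>(\<omega> in P k. sample X n \<omega> \<in> ?B)"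
    if "k \<in> carrier G" for k
  proof -
    interpret prob_space "P k" using prob that .
    have "(\<lambda>\<omega>. m (sample X n \<omega>)) -` C \<inter> space (P k) = {\<omega>\<in>space (P k). sample X n \<omega> \<in> ?B}"
      using sample_in_space by auto
    then show ?thesis
      using C measurable_compose[OF X[OF that] m] by (simp add: emeasure_distr emeasure_eq_measure)
  qed
  define k where "k = h \<otimes>\<^bsub>G\<^esub> inv\<^bsub>G\<^esub> g"
  have k: "k \<in> carrier G" "k \<otimes>\<^bsub>G\<^esub> g = h"
    using g h by (simp_all add: k_def m_assoc)
  have "\<P>(\<omega> in P (k \<otimes>\<^bsub>G\<^esub> g). sample X n \<omega> \<in> pow_action \<phi> n k ` ?B) = \<P>(\<omega> in P g. sample X n \<omega> \<in> ?B)"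
    using inv k(1) g B unfolding invariant_model_def by blast
  then show "emeasure (distr (P g) N (\<lambda>\<omega>. m (sample X n \<omega>))) C = emeasure (distr (P h) N (\<lambda>\<omega>. m (sample X n \<omega>))) C"
    using em[OF g] em[OF h] by (simp add: k(2) pow_action_image_saturated[OF act k(1) max])
qed simp

lemma absolutely_continuous_distributed:
  assumes "distributed P \<mu> X p" "distributed Q \<mu> X q"
    and "\<And>x. x \<in> space \<mu> \<Longrightarrow> p x = 0 \<Longrightarrow> q x = 0"
  shows "absolutely_continuous (distr P \<mu> X) (distr Q \<mu> X)"
proof -
  have "q \<in> borel_measurable \<mu>" "p \<in> borel_measurable \<mu>"
    using assms by (auto simp: distributed_def)
  then have "absolutely_continuous (density \<mu> p) (density \<mu> q)"
    unfolding absolutely_continuous_def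
  proof (intro subsetI)
    fix B assume "B \<in> null_sets (density \<mu> p)"
    then have "B \<in> sets \<mu>" "AE x in \<mu>. x \<in> B \<longrightarrow> p x = 0"
      using \<open>p \<in> _\<close> by (simp_all add: null_sets_density_iff)
    moreover from this(2) have "AE x in \<mu>. x \<in> B \<longrightarrow> q x = 0"
      using AE_space by eventually_elim (use assms(3) in blast)
    ultimately show "B \<in> null_sets (density \<mu> q)"
      using \<open>q \<in> _\<close> by (simp add: null_sets_density_iff)
  qed
  then show ?thesis using assms by (simp add: distributed_def)
qed

lemma absolutely_continuous_distr:
  assumes "absolutely_continuous R S" "sets R = sets S" "f \<in> R \<rightarrow>\<^sub>M N"
  shows "absolutely_continuous (distr R N f) (distr S N f)"
proof -
  have "f \<in> S \<rightarrow>\<^sub>M N"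
    using assms(3) measurable_cong_sets[OF assms(2) refl] by blast
  moreover have "space R = space S"
    using assms(2) by (rule sets_eq_imp_space_eq)
  ultimately show ?thesis
    using assms(1,3) by (auto simp: absolutely_continuous_def null_sets_distr_iff)
qed

text \<open>A process that is, at each time, a density of the restriction of one fixed \<open>Q\<close> to the current
  sigma-algebra is a martingale: at all later times the integral over an event is its
  \<open>Q\<close>-probability.\<close>

lemma likelihood_ratio_martingale_on:
  assumes P: "prob_space P" and Q: "prob_space Q" "sets Q = sets P"
    and sub: "\<And>i. i \<in> I \<Longrightarrow> subalgebra P (F i)"
    and mono: "\<And>i j. i \<in> I \<Longrightarrow> j \<in> I \<Longrightarrow> i \<le> j \<Longrightarrow> sets (F i) \<subseteq> sets (F j)"
    and meas: "\<And>i. i \<in> I \<Longrightarrow> T i \<in> borel_measurable (F i)"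
    and nonneg: "\<And>i \<omega>. i \<in> I \<Longrightarrow> \<omega> \<in> space P \<Longrightarrow> 0 \<le> T i \<omega>"
    and dens: "\<And>i A. i \<in> I \<Longrightarrow> A \<in> sets (F i) \<Longrightarrow> (\<integral>\<^sup>+\<omega>. ennreal (T i \<omega>) * indicator A \<omega> \<partial>P) = emeasure Q A"
  shows "martingale_on I P F T"
proof -
  interpret P: prob_space P by fact
  interpret Q: prob_space Q by fact
  have spQ: "space Q = space P" using Q(2) by (rule sets_eq_imp_space_eq)
  have measP: "T i \<in> borel_measurable P" if "i \<in> I" for i
    using measurable_from_subalg[OF sub[OF that] meas[OF that]] .
  have int: "integrable P (T i)" if i: "i \<in> I" for i
  proof (rule integrableI_nonneg)
    have "(\<integral>\<^sup>+\<omega>. ennreal (T i \<omega>) \<partial>P) = (\<integral>\<^sup>+\<omega>. ennreal (T i \<omega>) * indicator (space P) \<omega> \<partial>P)"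
      by (intro nn_integral_cong) simp
    also have "space P = space (F i)" using sub[OF i] by (simp add: subalgebra_def)
    also have "(\<integral>\<^sup>+\<omega>. ennreal (T i \<omega>) * indicator (space (F i)) \<omega> \<partial>P) = emeasure Q (space (F i))"
      using dens[OF i sets.top] .
    finally show "(\<integral>\<^sup>+\<omega>. ennreal (T i \<omega>) \<partial>P) < \<infinity>"
      using Q.emeasure_finite by (simp add: less_top[symmetric])
  qed (use nonneg measP i in auto)
  have set_int: "(LINT \<omega>:A|P. T i \<omega>) = measure Q A" if i: "i \<in> I" and A: "A \<in> sets (F i)" for i A
  proof -
    have [measurable]: "A \<in> sets P" using sub[OF i] A by (auto simp: subalgebra_def)
    note [measurable] = measP[OF i]
    have "(LINT \<omega>:A|P. T i \<omega>) = enn2real (\<integral>\<^sup>+\<omega>. ennreal (indicator A \<omega> * T i \<omega>) \<partial>P)"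
      unfolding set_lebesgue_integral_def using nonneg[OF i]
      by (subst integral_eq_nn_integral) (auto intro!: AE_I2)
    also have "(\<integral>\<^sup>+\<omega>. ennreal (indicator A \<omega> * T i \<omega>) \<partial>P) = (\<integral>\<^sup>+\<omega>. ennreal (T i \<omega>) * indicator A \<omega> \<partial>P)"
      by (intro nn_integral_cong) (simp split: split_indicator)
    finally show ?thesis by (simp add: dens[OF i A] measure_def)
  qed
  have cond: "AE \<omega> in P. real_cond_exp P (F i) (T j) \<omega> = T i \<omega>" if ij: "i \<in> I" "j \<in> I" "i \<le> j" for i j
  proof -
    interpret finite_measure_subalgebra P "F i"
      by unfold_locales (rule sub[OF ij(1)])
    show ?thesis
      using mono[OF ij] set_int ij int meas by (intro real_cond_exp_charact) auto
  qed
  show ?thesis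
    unfolding martingale_on_def by (intro conjI ballI impI sub mono meas int cond)
qed


section \<open>The likelihood ratio of the maximal invariants is a martingale\<close>

theorem proposition6:
  fixes G :: "('g, 'c) monoid_scheme"
    and \<phi> :: "'g \<Rightarrow> 'x::polish_space \<Rightarrow> 'x"
    and \<Omega> :: "'w measure"
    and X :: "nat \<Rightarrow> 'w \<Rightarrow> 'x"
    and P Q :: "'g \<Rightarrow> 'w measure"
    and \<mu> :: "nat \<Rightarrow> (nat \<Rightarrow> 'x) measure"
    and p q :: "nat \<Rightarrow> 'g \<Rightarrow> (nat \<Rightarrow> 'x) \<Rightarrow> real"
    and S :: "nat \<Rightarrow> (nat \<Rightarrow> 'x) set"
    and N \<nu> :: "nat \<Rightarrow> 'm measure"
    and m :: "nat \<Rightarrow> (nat \<Rightarrow> 'x) \<Rightarrow> 'm"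
    and pM qM :: "nat \<Rightarrow> 'm \<Rightarrow> real"
    and M :: "nat \<Rightarrow> 'w \<Rightarrow> 'm"
    and T :: "nat \<Rightarrow> 'w \<Rightarrow> real"
  assumes "group G"
    and "free_action G UNIV \<phi>"
    and "\<And>g. g \<in> carrier G \<Longrightarrow> \<phi> g \<in> borel_measurable borel"
    and "\<And>g. g \<in> carrier G \<Longrightarrow> prob_space (P g) \<and> sets (P g) = sets \<Omega>"
    and "\<And>g. g \<in> carrier G \<Longrightarrow> prob_space (Q g) \<and> sets (Q g) = sets \<Omega>"
    and "\<And>i. 1 \<le> i \<Longrightarrow> X i \<in> borel_measurable \<Omega>"
    and "\<And>n. 1 \<le> n \<Longrightarrow> invariant_model G (pow_action \<phi> n) (obs_space n) (sample X n) P"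
    and "\<And>n. 1 \<le> n \<Longrightarrow> invariant_model G (pow_action \<phi> n) (obs_space n) (sample X n) Q"
    and "\<And>n. 1 \<le> n \<Longrightarrow> sets (\<mu> n) = sets (obs_space n)"
    and "\<And>n. 1 \<le> n \<Longrightarrow> relatively_left_invariant G (pow_action \<phi> n) (\<mu> n)"
    and "\<And>n g. 1 \<le> n \<Longrightarrow> g \<in> carrier G \<Longrightarrow> distributed (P g) (\<mu> n) (sample X n) (\<lambda>x. ennreal (p n g x))"
    and "\<And>n g. 1 \<le> n \<Longrightarrow> g \<in> carrier G \<Longrightarrow> distributed (Q g) (\<mu> n) (sample X n) (\<lambda>x. ennreal (q n g x))"
    and "\<And>n g x. 1 \<le> n \<Longrightarrow> g \<in> carrier G \<Longrightarrow> x \<in> space (obs_space n) \<Longrightarrow> 0 \<le> p n g x \<and> 0 \<le> q n g x"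
    and "\<And>n g. 1 \<le> n \<Longrightarrow> g \<in> carrier G \<Longrightarrow> {x \<in> space (obs_space n). 0 < p n g x} = S n"
    and "\<And>n g. 1 \<le> n \<Longrightarrow> g \<in> carrier G \<Longrightarrow> {x \<in> space (obs_space n). 0 < q n g x} = S n"
    and "\<And>n. 1 \<le> n \<Longrightarrow> standard_borel (N n)"
    and "\<And>n. 1 \<le> n \<Longrightarrow> m n \<in> obs_space n \<rightarrow>\<^sub>M N n"
    and "\<And>n. 1 \<le> n \<Longrightarrow> maximally_invariant G (pow_action \<phi> n) (space (obs_space n)) (m n)"
    and M_def: "\<And>n \<omega>. M n \<omega> = m n (sample X n \<omega>)"
    and "\<And>n. 1 \<le> n \<Longrightarrow> sets (\<nu> n) = sets (N n)"
    and "\<And>n. 1 \<le> n \<Longrightarrow> \<exists>g\<in>carrier G. distributed (P g) (\<nu> n) (M n) (\<lambda>y. ennreal (pM n y))"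
    and "\<And>n. 1 \<le> n \<Longrightarrow> \<exists>g\<in>carrier G. distributed (Q g) (\<nu> n) (M n) (\<lambda>y. ennreal (qM n y))"
    and "\<And>n y. 1 \<le> n \<Longrightarrow> y \<in> space (N n) \<Longrightarrow> 0 \<le> pM n y \<and> 0 \<le> qM n y"
    and T_def: "\<And>n \<omega>. T n \<omega> = qM n (m n (sample X n \<omega>)) / pM n (m n (sample X n \<omega>))"
  shows "\<forall>g\<in>carrier G. (\<forall>n\<ge>1. \<forall>\<omega>\<in>space (P g). 0 \<le> T n \<omega>) \<and>
           martingale_on {1..} (P g) (natural_filtration (space \<Omega>) N M) T"
proof
  fix g assume g: "g \<in> carrier G"
  note P = assms(4) and Q = assms(5) and invP = assms(7) and invQ = assms(8) and N = assms(16)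
    and m = assms(17) and max = assms(18) and \<nu> = assms(20)
  interpret P: prob_space "P g" using P[OF g] by simp
  interpret Q: prob_space "Q g" using Q[OF g] by simp
  have act: "group_action G UNIV \<phi>"
    using assms(2) by (simp add: free_action_def)
  have sp: "space (P g) = space \<Omega>" "space (Q g) = space \<Omega>"
    using P[OF g] Q[OF g] by (auto dest: sets_eq_imp_space_eq)
  have X: "sample X n \<in> \<Omega> \<rightarrow>\<^sub>M obs_space n" for n
    unfolding sample_def[abs_def] obs_space_def by (rule measurable_restrict) (use assms(6) in auto)
  have XP: "sample X n \<in> P h \<rightarrow>\<^sub>M obs_space n" and XQ: "sample X n \<in> Q h \<rightarrow>\<^sub>M obs_space n"
    if "h \<in> carrier G" for n h
    using X P[OF that] Q[OF that] by (simp_all cong: measurable_cong_sets)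
  have M\<Omega>: "M n \<in> \<Omega> \<rightarrow>\<^sub>M N n" if "1 \<le> n" for n
    using measurable_compose[OF X m[OF that]] by (simp add: M_def[abs_def])
  let ?F = "natural_filtration (space \<Omega>) N M"
  have F_gen: "(\<Union>k\<in>{1..n}. {M k -` A \<inter> space \<Omega> |A. A \<in> sets (N k)}) \<subseteq> sets \<Omega>" for n
    using M\<Omega> by (auto intro: measurable_sets)
  have F_space: "space (?F n) = space \<Omega>" for n
    by (simp add: natural_filtration_def space_measure_of_conv)
  have F_sets: "sets (?F n) = sigma_sets (space \<Omega>) (\<Union>k\<in>{1..n}. {M k -` A \<inter> space \<Omega> |A. A \<in> sets (N k)})" for n
    unfolding natural_filtration_def by (rule sets_measure_of) auto
  have F_sub: "subalgebra (P g) (?F n)" for n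
    unfolding subalgebra_def F_space F_sets using sets.sigma_sets_subset[OF F_gen] P[OF g] sp by simp
  have F_mono: "sets (?F i) \<subseteq> sets (?F j)" if "i \<le> j" for i j
    unfolding F_sets using that by (intro sigma_sets_mono') (auto; force)
  have M_F: "M n \<in> ?F n \<rightarrow>\<^sub>M N n" if n: "1 \<le> n" for n
  proof (rule measurableI)
    show "M n \<omega> \<in> space (N n)" if "\<omega> \<in> space (?F n)" for \<omega>
      using measurable_space[OF M\<Omega>[OF n]] that by (simp add: F_space)
    show "M n -` A \<inter> space (?F n) \<in> sets (?F n)" if "A \<in> sets (N n)" for A
      unfolding F_sets F_space by (intro sigma_sets.Basic UN_I[of n]) (use that n in auto)
  qed
  have law: "distributed (P g) (\<nu> n) (M n) (\<lambda>y. ennreal (pM n y))"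
    "distributed (Q g) (\<nu> n) (M n) (\<lambda>y. ennreal (qM n y))" if n: "1 \<le> n" for n
  proof -
    obtain h where h: "h \<in> carrier G" "distributed (P h) (\<nu> n) (M n) (\<lambda>y. ennreal (pM n y))"
      using assms(21)[OF n] by blast
    have "distr (P g) (\<nu> n) (M n) = distr (P h) (\<nu> n) (M n)"
      using distr_maximal_invariant_eq[OF act _ XP invP[OF n] _ max[OF n] g h(1), where N="\<nu> n"] P m[OF n] \<nu>[OF n]
      by (simp add: M_def[abs_def] cong: measurable_cong_sets)
    then show "distributed (P g) (\<nu> n) (M n) (\<lambda>y. ennreal (pM n y))"
      using h(2) M\<Omega>[OF n] P[OF g] \<nu>[OF n] by (simp add: distributed_def cong: measurable_cong_sets)
    obtain h where h: "h \<in> carrier G" "distributed (Q h) (\<nu> n) (M n) (\<lambda>y. ennreal (qM n y))"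
      using assms(22)[OF n] by blast
    have "distr (Q g) (\<nu> n) (M n) = distr (Q h) (\<nu> n) (M n)"
      using distr_maximal_invariant_eq[OF act _ XQ invQ[OF n] _ max[OF n] g h(1), where N="\<nu> n"] Q m[OF n] \<nu>[OF n]
      by (simp add: M_def[abs_def] cong: measurable_cong_sets)
    then show "distributed (Q g) (\<nu> n) (M n) (\<lambda>y. ennreal (qM n y))"
      using h(2) M\<Omega>[OF n] Q[OF g] \<nu>[OF n] by (simp add: distributed_def cong: measurable_cong_sets)
  qed
  have space_\<nu>: "space (\<nu> n) = space (N n)" if "1 \<le> n" for n
    using \<nu>[OF that] by (rule sets_eq_imp_space_eq)
  have pqM: "0 \<le> pM n y \<and> 0 \<le> qM n y" if "1 \<le> n" "y \<in> space (\<nu> n)" for n y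
    using assms(23) that space_\<nu> by simp
  have ac: "absolutely_continuous (distr (P g) (obs_space n) (sample X n)) (distr (Q g) (obs_space n) (sample X n))"
    if n: "1 \<le> n" for n
  proof -
    have "absolutely_continuous (distr (P g) (\<mu> n) (sample X n)) (distr (Q g) (\<mu> n) (sample X n))"
    proof (rule absolutely_continuous_distributed[OF assms(11)[OF n g] assms(12)[OF n g]])
      fix x assume "x \<in> space (\<mu> n)" and p0: "ennreal (p n g x) = 0"
      then have x: "x \<in> space (obs_space n)"
        using sets_eq_imp_space_eq[OF assms(9)[OF n]] by simp
      have "x \<notin> S n"
        using p0 unfolding assms(14)[OF n g, symmetric] by (simp add: ennreal_eq_0_iff)
      then have "\<not> 0 < q n g x"
        using x unfolding assms(15)[OF n g, symmetric] by simp
      then show "ennreal (q n g x) = 0" by (simp add: ennreal_neg)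
    qed
    then show ?thesis
      by (simp only: distr_cong[OF refl assms(9)[OF n] refl])
  qed
  have acM: "absolutely_continuous (distr (P g) (\<nu> n) (M n)) (distr (Q g) (\<nu> n) (M n))" if n: "1 \<le> n" for n
  proof -
    have m': "m n \<in> obs_space n \<rightarrow>\<^sub>M \<nu> n" using m[OF n] \<nu>[OF n] by (simp cong: measurable_cong_sets)
    show ?thesis
      using absolutely_continuous_distr[OF ac[OF n], of "m n" "\<nu> n"] XP[OF g, of n] XQ[OF g, of n] m'
      by (simp add: distr_distr comp_def M_def[abs_def])
  qed
  have T: "T n = (\<lambda>\<omega>. qM n (M n \<omega>) / pM n (M n \<omega>))" for n
    by (simp add: fun_eq_iff T_def M_def)
  have T_nonneg: "0 \<le> T n \<omega>" if "1 \<le> n" "\<omega> \<in> space (P g)" for n \<omega>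
    using pqM[OF that(1), of "M n \<omega>"] measurable_space[OF M\<Omega>[OF that(1)]] that sp space_\<nu> by (simp add: T)
  have "martingale_on {1..} (P g) ?F T"
  proof (rule likelihood_ratio_martingale_on)
    show "prob_space (P g)" "prob_space (Q g)" by unfold_locales
    show "sets (Q g) = sets (P g)" using P[OF g] Q[OF g] by simp
    show "subalgebra (P g) (?F i)" for i by (rule F_sub)
    show "sets (?F i) \<subseteq> sets (?F j)" if "i \<le> j" for i j using that by (rule F_mono)
    show "T n \<in> borel_measurable (?F n)" if "n \<in> {1..}" for n
    proof -
      have n: "1 \<le> n" using that by simp
      have "pM n \<in> borel_measurable (\<nu> n)" "qM n \<in> borel_measurable (\<nu> n)"
        using distributed_real_measurable[OF _ law(1)[OF n]] distributed_real_measurable[OF _ law(2)[OF n]] pqM[OF n] by auto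
      moreover have "M n \<in> ?F n \<rightarrow>\<^sub>M \<nu> n"
        using M_F[OF n] \<nu>[OF n] by (simp cong: measurable_cong_sets)
      ultimately show ?thesis unfolding T by measurable
    qed
    show "0 \<le> T i \<omega>" if "i \<in> {1..}" "\<omega> \<in> space (P g)" for i \<omega>
      using T_nonneg that by simp
    show "(\<integral>\<^sup>+\<omega>. ennreal (T n \<omega>) * indicator A \<omega> \<partial>P g) = emeasure (Q g) A"
      if "n \<in> {1..}" and A: "A \<in> sets (?F n)" for n A
    proof -
      have n: "1 \<le> n" using that by simp
      \<comment> \<open>Replacing \<open>A\<close> by an event of \<open>M n\<close> leaves both sides unchanged, as the exceptional set is null
        under \<open>P g\<close> (left) and under \<open>Q g\<close> (right).\<close>
      obtain C where C: "C \<in> sets (N n)" "AE \<omega> in P g. \<omega> \<in> A \<longleftrightarrow> M n \<omega> \<in> C" "AE \<omega> in Q g. \<omega> \<in> A \<longleftrightarrow> M n \<omega> \<in> C"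
        by (rule natural_filtration_eq_vimage_AE[OF P.prob_space_axioms sp n XP[OF g] XQ[OF g] ac[OF n] N[OF n] m max M_def A])
      have "(\<integral>\<^sup>+\<omega>. ennreal (T n \<omega>) * indicator A \<omega> \<partial>P g) = (\<integral>\<^sup>+\<omega>. ennreal (T n \<omega>) * indicator C (M n \<omega>) \<partial>P g)"
        using C(2) by (intro nn_integral_cong_AE) (auto simp: indicator_def elim!: eventually_mono)
      also have "\<dots> = emeasure (Q g) (M n -` C \<inter> space (Q g))"
        unfolding T using C(1) \<nu>[OF n]
        by (intro nn_integral_density_ratio[OF law(1)[OF n] law(2)[OF n] pqM[OF n] acM[OF n]]) auto
      also have "\<dots> = emeasure (Q g) A"
      proof (rule emeasure_eq_AE)
        show "AE \<omega> in Q g. \<omega> \<in> M n -` C \<inter> space (Q g) \<longleftrightarrow> \<omega> \<in> A"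
          using C(3) AE_space by eventually_elim auto
        show "M n -` C \<inter> space (Q g) \<in> sets (Q g)"
          using measurable_sets[OF M\<Omega>[OF n] C(1)] Q[OF g] sp by simp
        show "A \<in> sets (Q g)"
          using F_sub A P[OF g] Q[OF g] by (auto simp: subalgebra_def)
      qed
      finally show ?thesis .
    qed
  qed
  then show "(\<forall>n\<ge>1. \<forall>\<omega>\<in>space (P g). 0 \<le> T n \<omega>) \<and> martingale_on {1..} (P g) ?F T"
    using T_nonneg by blast
qed

end
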